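(* For all integers $d\ge1$, $\kappa\ge1$ and all $m\in\mathbb{N}$, $$\left\{\cos(j\pi/\kappa):0\le j\le\kappa\right\}+\boldsymbol{\Theta}_{m,\kappa}(\Delta[d])\subset\boldsymbol{\Theta}_{m,\kappa}(\Delta[d+1]),$$ where the left-hand side is the sumset $\{a+b\}$.
   Context: $\mathbb{N}=\{0,1,2,\dots\}$, $\mathbb{N}^*=\{1,2,\dots\}$. $\Delta[d]$ is the discrete Laplacian $\sum_{i=1}^d\frac12(S_i+S_i^* )$ on $\ell^2(\mathbb{Z}^d)$, where $S_i$ is the unit shift in the $i$-th coordinate; its spectrum is $[-d,d]$. Let $U_n$ be the Chebyshev polynomial of the second kind of degree $n$. For $\vec{x}=(x_1,\dots,x_d)\in[-1,1]^d$ and $j\in\mathbb{N}^*$ let $g_{j\kappa}(\vec{x})=\sum_{i=1}^d(1-x_i^2)U_{j\kappa-1}(x_i)$, and for $E\in[-d,d]$ let $S_E=\{\vec{x}\in[-1,1]^d:x_1+\dots+x_d=E\}$. $E\in\boldsymbol{\Theta}_{0,\kappa}(\Delta[d])$ iff there is $\vec{x}\in S_E$ with $g_{j\kappa}(\vec{x})=0$ for all $j\in\mathbb{N}^*$. For $m\in\mathbb{N}^*$, $E\in\boldsymbol{\Theta}_{m,\kappa}(\Delta[d])$ iff there exist $\vec{x}_0,\dots,\vec{x}_m\in S_E$ and real numbers $\omega_0,\dots,\omega_{m-1}\le0$ such that $g_{j\kappa}(\vec{x}_m)=\sum_{q=0}^{m-1}\omega_q\,g_{j\kappa}(\vec{x}_q)$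 for all $j\in\mathbb{N}^*$. *)

theory Defs
  imports
    Complex_Main
    "HOL-Library.FuncSet"
    "HOL-Library.Set_Algebras"
    "HOL-Computational_Algebra.Polynomial"
begin

fun chebyshev_U :: "nat \<Rightarrow> real poly" where
  "chebyshev_U 0 = 1"
| "chebyshev_U (Suc 0) = [:0, 2:]"
| "chebyshev_U (Suc (Suc n)) = [:0, 2:] * chebyshev_U (Suc n) - chebyshev_U n"

text \<open>
  Points of \<open>\<real>\<^sup>d\<close> are functions on the index set \<open>{1..d}\<close> (extensional, see \<open>S_set\<close>), so that
  the dimensions \<open>d\<close> and \<open>d + 1\<close> can occur in one statement.
  The function \<open>g d n\<close> is only meaningful for \<open>n \<ge> 1\<close> (truncated subtraction \<open>n - 1\<close>);
  it is used for \<open>n = j * \<kappa>\<close> with \<open>j, \<kappa> \<ge> 1\<close>.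
\<close>

definition g :: "nat \<Rightarrow> nat \<Rightarrow> (nat \<Rightarrow> real) \<Rightarrow> real" where
  "g d n x = (\<Sum>i = 1..d. (1 - (x i)\<^sup>2) * poly (chebyshev_U (n - 1)) (x i))"

definition S_set :: "nat \<Rightarrow> real \<Rightarrow> (nat \<Rightarrow> real) set" where
  "S_set d E = {x \<in> {1..d} \<rightarrow>\<^sub>E {-1..1}. (\<Sum>i = 1..d. x i) = E}"

text \<open>
  \<open>Theta m \<kappa> d\<close> is the set \<open>\<Theta>\<^bsub>m,\<kappa>\<^esub>(\<Delta>[d])\<close>; the energies range over the interval \<open>[-d, d]\<close>,
  the spectrum of \<open>\<Delta>[d]\<close>.
\<close>

definition Theta :: "nat \<Rightarrow> nat \<Rightarrow> nat \<Rightarrow> real set" where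
  "Theta m \<kappa> d =
    (if m = 0
     then {E \<in> {- real d..real d}. \<exists>x \<in> S_set d E. \<forall>j\<ge>1. g d (j * \<kappa>) x = 0}
     else {E \<in> {- real d..real d}.
            \<exists>(x :: nat \<Rightarrow> nat \<Rightarrow> real) (\<omega> :: nat \<Rightarrow> real).
              (\<forall>q\<le>m. x q \<in> S_set d E) \<and> (\<forall>q<m. \<omega> q \<le> 0) \<and>
              (\<forall>j\<ge>1. g d (j * \<kappa>) (x m) = (\<Sum>q<m. \<omega> q * g d (j * \<kappa>) (x q)))})"

end

theory Submission
  imports Defs
begin

text \<open>
  The identity \<open>sin t * U\<^sub>n (cos t) = sin ((n + 1) t)\<close> gives
  \<open>(1 - cos\<^sup>2 t) U\<^bsub>n \<kappa> - 1\<^esub> (cos t) = sin t * sin (n \<kappa> t)\<close> for \<open>n \<kappa> \<ge> 1\<close>. When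
  \<open>t = j \<pi> / \<kappa>\<close>, the right-hand side vanishes for every \<open>n\<close>, because \<open>n \<kappa> t\<close> is then a multiple
  of \<open>\<pi>\<close>. So appending \<open>a = cos (j \<pi> / \<kappa>)\<close> as a further coordinate
  changes none of the values of \<open>g\<close> at multiples of \<open>\<kappa>\<close>, while it raises the energy
  by \<open>a\<close>. Appending \<open>a\<close> to every point that witnesses an energy \<open>E\<close> in
  dimension \<open>d\<close>, with the same weights \<open>\<omega>\<close>, therefore gives witnesses for
  \<open>a + E\<close> in dimension \<open>d + 1\<close>.
\<close>

lemma sin_times_chebyshev_U:
  "sin t * poly (chebyshev_U n) (cos t) = sin (real (Suc n) * t)"
proof (induction n rule: chebyshev_U.induct)
  case 1
  show ?case by simp
next
  case 2
  show ?case using sin_double[of t] by simp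
next
  case (3 n)
  let ?s = "real (Suc (Suc n)) * t"
  have "sin t * poly (chebyshev_U (Suc (Suc n))) (cos t)
      = 2 * cos t * (sin t * poly (chebyshev_U (Suc n)) (cos t))
        - sin t * poly (chebyshev_U n) (cos t)"
    by (simp add: algebra_simps)
  also have "\<dots> = 2 * cos t * sin ?s - sin (?s - t)"
    using 3 by (simp add: algebra_simps)
  also have "\<dots> = sin (?s + t)"
    by (simp add: sin_add sin_diff)
  also have "?s + t = real (Suc (Suc (Suc n))) * t"
    by (simp add: algebra_simps)
  finally show ?case .
qed

lemma chebyshev_term_vanishes:
  fixes n \<kappa> j :: nat
  assumes "n \<ge> 1" and "\<kappa> \<ge> 1"
  defines "a \<equiv> cos (real j * pi / real \<kappa>)"
  shows "(1 - a\<^sup>2) * poly (chebyshev_U (n * \<kappa> - 1)) a = 0"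
proof -
  let ?t = "real j * pi / real \<kappa>"
  have "Suc (n * \<kappa> - 1) = n * \<kappa>"
    using assms(1,2) by simp
  then have "sin ?t * poly (chebyshev_U (n * \<kappa> - 1)) a = sin (real (n * \<kappa>) * ?t)"
    using sin_times_chebyshev_U[of ?t "n * \<kappa> - 1"] unfolding a_def by simp
  also have "real (n * \<kappa>) * ?t = real (n * j) * pi"
    using assms(2) by simp
  also have "sin \<dots> = 0"
    by (rule sin_npi)
  finally have "sin ?t * (sin ?t * poly (chebyshev_U (n * \<kappa> - 1)) a) = 0"
    by simp
  moreover have "1 - a\<^sup>2 = sin ?t * sin ?t"
    unfolding a_def using sin_squared_eq[of ?t] by (simp add: power2_eq_square)
  ultimately show ?thesis
    by (simp only: mult.assoc)
qed

lemma g_append: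
  "g (Suc d) n (x(Suc d := a)) = g d n x + (1 - a\<^sup>2) * poly (chebyshev_U (n - 1)) a"
  unfolding g_def by simp

lemma S_set_append:
  assumes "x \<in> S_set d E" and "a \<in> {-1..1}"
  shows "x(Suc d := a) \<in> S_set (Suc d) (a + E)"
proof -
  have "x \<in> {1..d} \<rightarrow>\<^sub>E {-1..1}" and sum: "(\<Sum>i = 1..d. x i) = E"
    using assms(1) by (auto simp: S_set_def)
  then have "x(Suc d := a) \<in> insert (Suc d) {1..d} \<rightarrow>\<^sub>E {-1..1}"
    using assms(2) by (intro PiE_fun_upd)
  then show ?thesis
    using sum by (simp add: S_set_def atLeastAtMostSuc_conv)
qed

text \<open>
  A coordinate in \<open>[-1, 1]\<close> that contributes nothing to \<open>g\<close> at multiples of \<open>\<kappa>\<close> may be appended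
  to all witnesses at once: the linear relations that define \<open>Theta\<close> compare values of \<open>g\<close> only,
  so they carry over with the same weights.
\<close>

lemma Theta_append:
  assumes E: "E \<in> Theta m \<kappa> d" and a: "a \<in> {-1..1}"
    and vanish: "\<And>n. n \<ge> 1 \<Longrightarrow> (1 - a\<^sup>2) * poly (chebyshev_U (n * \<kappa> - 1)) a = 0"
  shows "a + E \<in> Theta m \<kappa> (Suc d)"
proof -
  have g_eq: "g (Suc d) (n * \<kappa>) (x(Suc d := a)) = g d (n * \<kappa>) x" if "n \<ge> 1" for n x
    using vanish[OF that] by (simp only: g_append add_0_right)
  have "E \<in> {- real d..real d}"
    using E by (auto simp: Theta_def split: if_splits)
  then have range: "a + E \<in> {- real (Suc d)..real (Suc d)}"
    using a by simp
  show ?thesis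
  proof (cases "m = 0")
    case True
    then obtain x where "x \<in> S_set d E" and "\<forall>n\<ge>1. g d (n * \<kappa>) x = 0"
      using E by (auto simp: Theta_def)
    then have "x(Suc d := a) \<in> S_set (Suc d) (a + E)"
      and "\<forall>n\<ge>1. g (Suc d) (n * \<kappa>) (x(Suc d := a)) = 0"
      using S_set_append[OF _ a] g_eq by auto
    then show ?thesis
      using True range unfolding Theta_def by auto
  next
    case False
    then obtain x \<omega> where "\<forall>q\<le>m. x q \<in> S_set d E" and \<omega>: "\<forall>q<m. \<omega> q \<le> 0"
      and "\<forall>n\<ge>1. g d (n * \<kappa>) (x m) = (\<Sum>q<m. \<omega> q * g d (n * \<kappa>) (x q))"
      using E by (auto simp: Theta_def)
    moreover define y where "y q = (x q)(Suc d := a)" for q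
    ultimately have "\<forall>q\<le>m. y q \<in> S_set (Suc d) (a + E)"
      and "\<forall>n\<ge>1. g (Suc d) (n * \<kappa>) (y m) = (\<Sum>q<m. \<omega> q * g (Suc d) (n * \<kappa>) (y q))"
      using S_set_append[OF _ a] g_eq by auto
    with \<omega> False range show ?thesis
      unfolding Theta_def by auto
  qed
qed

theorem lemma1p17:
  fixes d \<kappa> m :: nat
  assumes "d \<ge> 1" and "\<kappa> \<ge> 1"
  shows "{cos (real j * pi / real \<kappa>) | j :: nat. j \<le> \<kappa>} + Theta m \<kappa> d \<subseteq> Theta m \<kappa> (d + 1)"
proof
  fix F
  assume "F \<in> {cos (real j * pi / real \<kappa>) | j :: nat. j \<le> \<kappa>} + Theta m \<kappa> d"
  then obtain j E where F: "F = cos (real j * pi / real \<kappa>) + E" and E: "E \<in> Theta m \<kappa> d"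
    by (auto elim!: set_plus_elim)
  have "cos (real j * pi / real \<kappa>) + E \<in> Theta m \<kappa> (Suc d)"
    using E _ chebyshev_term_vanishes[OF _ assms(2)] by (rule Theta_append) simp
  then show "F \<in> Theta m \<kappa> (d + 1)"
    by (simp add: F)
qed

end
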